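(* If $G$ is a finite nonabelian characteristically simple $\mathfrak{D}_n$-group, then $n\geq |\pi(G)|+2$.
   Context: A derived subgroup of a group $G$ means a subgroup of the form $H'=[H,H]$ for some subgroup $H\le G$ (including $H=G$ and $H=1$). $G$ is called a $\mathfrak{D}_n$-group if the set $\{H' : H\le G\}$ consists of exactly $n$ isomorphism classes of groups. $\pi(G)$ denotes the set of prime divisors of $|G|$. A group is characteristically simple if it has no characteristic subgroups other than $1$ and itself. *)

theory Defs
  imports "HOL-Algebra.Algebra"
begin

definition derived_subgroups :: "('a, 'b) monoid_scheme \<Rightarrow> 'a set set" where
  "derived_subgroups G = {derived G H | H. subgroup H G}"

definition derived_iso_rel :: "('a, 'b) monoid_scheme \<Rightarrow> ('a set \<times> 'a set) set" where
  "derived_iso_rel G =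
     {(A, B). A \<in> derived_subgroups G \<and> B \<in> derived_subgroups G \<and>
              G\<lparr>carrier := A\<rparr> \<cong> G\<lparr>carrier := B\<rparr>}"

lemma (in group) equiv_derived_iso_rel: "equiv (derived_subgroups G) (derived_iso_rel G)"
proof -
  have grp: "group (G\<lparr>carrier := A\<rparr>)" if "A \<in> derived_subgroups G" for A
    using that derived_is_subgroup subgroup.subset subgroup.subgroup_is_group is_group
    unfolding derived_subgroups_def by blast
  show ?thesis
  proof (rule equivI)
    show "derived_iso_rel G \<subseteq> derived_subgroups G \<times> derived_subgroups G"
      by (auto simp: derived_iso_rel_def)
    show "refl_on (derived_subgroups G) (derived_iso_rel G)"
      by (auto simp: refl_on_def derived_iso_rel_def iso_refl)
    show "sym (derived_iso_rel G)"
      using group.iso_sym[OF grp] by (auto simp: sym_def derived_iso_rel_def)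
    show "trans (derived_iso_rel G)"
      unfolding trans_def derived_iso_rel_def by (blast intro: iso_trans)
  qed
qed

text \<open>
  The isomorphism classes of derived subgroups are counted as equivalence classes inside
  the set of derived subgroups. Finiteness is required explicitly, since \<open>card\<close> of an
  infinite set is \<open>0\<close>.
\<close>

definition Dn_group :: "nat \<Rightarrow> ('a, 'b) monoid_scheme \<Rightarrow> bool" where
  "Dn_group n G \<longleftrightarrow> group G \<and>
     finite (derived_subgroups G // derived_iso_rel G) \<and>
     card (derived_subgroups G // derived_iso_rel G) = n"

definition characteristic_subgroup :: "'a set \<Rightarrow> ('a, 'b) monoid_scheme \<Rightarrow> bool" where
  "characteristic_subgroup H G \<longleftrightarrow> subgroup H G \<and> (\<forall>\<phi> \<in> auto G. \<phi> ` H = H)"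

definition characteristically_simple :: "('a, 'b) monoid_scheme \<Rightarrow> bool" where
  "characteristically_simple G \<longleftrightarrow> group G \<and>
     (\<forall>H. characteristic_subgroup H G \<longrightarrow> H = {\<one>\<^bsub>G\<^esub>} \<or> H = carrier G)"

end

theory Submission
  imports Defs
begin

text \<open>
  A characteristically simple nonabelian group \<open>G\<close> is perfect, because \<open>G'\<close> is characteristic and
  nontrivial; and it is not a group of prime power order, because such a group has a nontrivial
  centre, which is again characteristic. So \<open>1\<close> and \<open>G\<close> are derived subgroups, and the orders
  show that neither is isomorphic to a nontrivial \<open>p\<close>-group. The theorem follows once every
  prime \<open>p\<close> dividing the order of \<open>G\<close> has a subgroup \<open>H\<close> for which \<open>H'\<close> is a nontrivial
  \<open>p\<close>-group; the resulting \<open>|\<pi>(G)| + 2\<close> derived subgroups have pairwise different orders.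
  That \<open>H\<close> exists is a property of perfect groups (\<open>perfect_prime_power_derived_subgroup\<close>).

  Let \<open>P\<close> be a Sylow \<open>p\<close>-subgroup. If some \<open>x\<close> normalises \<open>P\<close> without centralising it, then
  \<open>H = P\<langle>x\<rangle>\<close> works: \<open>H/P\<close> is cyclic, so \<open>H'\<close> lies in \<open>P\<close>, and \<open>H'\<close> contains a nontrivial
  commutator of \<open>x\<close> with an element of \<open>P\<close>. This includes the case of a nonabelian \<open>P\<close>, where
  \<open>x\<close> can be taken in \<open>P\<close>. Otherwise \<open>P\<close> is central in its normaliser, and Burnside's transfer
  theorem (\<open>burnside_transfer\<close>) gives \<open>P \<inter> G' = 1\<close>, which contradicts \<open>G' = G\<close>.

  The transfer argument takes a short form here. Conjugation fixes every element of \<open>P\<close> that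
  it keeps in \<open>P\<close> (\<open>central_sylow_fusion\<close>), so the rule \<open>u t v \<mapsto> u v\<close> on a double coset
  \<open>P t P\<close> is well defined. It yields a map \<open>\<phi>\<close> from \<open>G\<close> to \<open>P\<close> that is equivariant for both the
  left and the right multiplication by \<open>P\<close>. Taking \<open>T\<close>, the set where \<open>\<phi>\<close> is \<open>1\<close>, as transversal,
  the transfer of \<open>u \<in> P\<close> is visibly \<open>u\<close> to the power \<open>|T|\<close>, the index of \<open>P\<close>, with no
  decomposition of \<open>T\<close> into cycles.
\<close>

section \<open>Actions of groups of prime power order\<close>

context group
begin

lemma inv_cancel_left [simp]:
  assumes "x \<in> carrier G" "y \<in> carrier G"
  shows "inv x \<otimes> (x \<otimes> y) = y" "x \<otimes> (inv x \<otimes> y) = y"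
  using assms by (simp_all add: m_assoc[symmetric])

lemma commute_if_conjugate_fixed:
  assumes "u \<in> carrier G" "v \<in> carrier G" "v \<otimes> u \<otimes> inv v = u"
  shows "u \<otimes> v = v \<otimes> u"
  using assms inv_solve_right[of u "v \<otimes> u" v] by simp

text \<open>
  The length of an orbit divides \<open>p\<close> to the power \<open>a\<close>, so it is \<open>1\<close> or a multiple of \<open>p\<close>. If all
  orbits had length divisible by \<open>p\<close>, so would the whole set.
\<close>

lemma prime_power_action_fixed_point:
  fixes E :: "'c set" and act :: "'a \<Rightarrow> 'c \<Rightarrow> 'c"
  assumes p: "Factorial_Ring.prime p" and ord: "order G = p ^ a"
    and fin: "finite E" and card: "\<not> p dvd card E"
    and closed: "\<And>g x. g \<in> carrier G \<Longrightarrow> x \<in> E \<Longrightarrow> act g x \<in> E"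
    and one: "\<And>x. x \<in> E \<Longrightarrow> act \<one> x = x"
    and mult: "\<And>g h x. g \<in> carrier G \<Longrightarrow> h \<in> carrier G \<Longrightarrow> x \<in> E \<Longrightarrow>
                 act (g \<otimes> h) x = act g (act h x)"
  obtains x where "x \<in> E" "\<And>g. g \<in> carrier G \<Longrightarrow> act g x = x"
proof -
  define \<phi> where "\<phi> g = restrict (act g) E" for g
  have inv_act: "act (inv g) (act g x) = x" "act g (act (inv g) x) = x"
    if "g \<in> carrier G" "x \<in> E" for g x
    using that mult[of "inv g" g x] mult[of g "inv g" x] one by simp_all
  have bij: "\<phi> g \<in> Bij E" if "g \<in> carrier G" for g
  proof -
    have "bij_betw (act g) E E"
      by (rule bij_betwI[where g = "act (inv g)"]) (use that closed inv_act in auto)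
    then show ?thesis by (simp add: \<phi>_def Bij_def)
  qed
  interpret group_action G E \<phi>
  proof (unfold group_action_def group_hom_def group_hom_axioms_def, intro conjI)
    show "group G" "group (BijGroup E)"
      by (rule is_group group_BijGroup)+
    show "\<phi> \<in> hom G (BijGroup E)"
    proof (rule homI)
      fix g h assume gh: "g \<in> carrier G" "h \<in> carrier G"
      have "\<phi> (g \<otimes> h) = compose E (\<phi> g) (\<phi> h)"
        using gh mult closed by (auto simp: \<phi>_def compose_def fun_eq_iff)
      then show "\<phi> (g \<otimes> h) = \<phi> g \<otimes>\<^bsub>BijGroup E\<^esub> \<phi> h"
        using gh bij by (simp add: BijGroup_def)
    qed (simp add: BijGroup_def bij)
  qed
  have orbit_card: "card orb = 1 \<or> p dvd card orb" if orb: "orb \<in> orbits G E \<phi>" for orb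
  proof -
    obtain x where x: "x \<in> E" "orb = orbit G \<phi> x"
      using orb by (auto simp: orbits_def)
    then have "card orb dvd p ^ a"
      using orbit_stabilizer_theorem[OF x(1)] ord by (metis dvd_triv_left)
    then obtain i where "card orb = p ^ i"
      using p divides_primepow_nat by blast
    then show ?thesis by (cases i) auto
  qed
  have "card E = (\<Sum>orb\<in>orbits G E \<phi>. card orb)"
    using disjoint_sum[OF fin, of "\<lambda>_. 1::nat"] by simp
  then obtain orb where orb: "orb \<in> orbits G E \<phi>" "\<not> p dvd card orb"
    using card dvd_sum by (metis (no_types, lifting))
  then obtain x where x: "x \<in> E" "orb = orbit G \<phi> x"
    by (auto simp: orbits_def)
  obtain y where y: "orb = {y}"
    using orbit_card orb card_1_singletonE by blast
  have "act g x = x" if "g \<in> carrier G" for g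
  proof -
    have "\<phi> g x \<in> orb" "\<phi> \<one> x \<in> orb"
      using that x by (auto simp: orbit_def)
    then show ?thesis using y x one by (simp add: \<phi>_def)
  qed
  with x(1) show thesis using that by blast
qed

text \<open>
  A central element is a fixed point of conjugation. Removing the neutral element leaves a set
  whose size is not divisible by \<open>p\<close>, so the fixed point found there is nontrivial.
\<close>

lemma prime_power_group_central_element:
  assumes p: "Factorial_Ring.prime p" and ord: "order G = p ^ a" and nt: "carrier G \<noteq> {\<one>}"
  obtains z where "z \<in> carrier G" "z \<noteq> \<one>" "\<And>g. g \<in> carrier G \<Longrightarrow> g \<otimes> z = z \<otimes> g"
proof -
  have fin: "finite (carrier G)"
    using ord p order_gt_0_iff_finite by (simp add: prime_gt_0_nat)
  have "a \<noteq> 0"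
  proof
    assume "a = 0"
    then have "card (carrier G) = 1" using ord by (simp add: order_def)
    then show False using nt one_closed by (metis card_1_singletonE singletonD)
  qed
  then have "p dvd card (carrier G)" using ord by (simp add: order_def)
  moreover have "card (carrier G) = Suc (card (carrier G - {\<one>}))"
    by (rule card.remove[OF fin one_closed])
  ultimately have card: "\<not> p dvd card (carrier G - {\<one>})"
    using p by (metis dvd_add_right_iff not_prime_unit plus_1_eq_Suc add.commute)
  have eq_one: "x = \<one>" if "g \<otimes> x \<otimes> inv g = \<one>" "g \<in> carrier G" "x \<in> carrier G" for g x
  proof -
    have "x = inv g \<otimes> (g \<otimes> x \<otimes> inv g) \<otimes> g" using that(2,3) by (simp add: m_assoc)
    also have "\<dots> = \<one>" unfolding that(1) using that(2) by simp
    finally show ?thesis .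
  qed
  obtain z where z: "z \<in> carrier G - {\<one>}" "\<And>g. g \<in> carrier G \<Longrightarrow> g \<otimes> z \<otimes> inv g = z"
  proof (rule prime_power_action_fixed_point[OF p ord, of "carrier G - {\<one>}" "\<lambda>g x. g \<otimes> x \<otimes> inv g"])
    show "g \<otimes> x \<otimes> inv g \<in> carrier G - {\<one>}" if "g \<in> carrier G" "x \<in> carrier G - {\<one>}" for g x
      using that eq_one[of g x] by blast
  qed (use fin card in \<open>auto simp: m_assoc inv_mult_group\<close>)
  show thesis
  proof (rule that)
    fix g assume "g \<in> carrier G"
    then show "g \<otimes> z = z \<otimes> g"
      using z(1) commute_if_conjugate_fixed[OF _ _ z(2)] by (metis DiffD1)
  qed (use z in auto)
qed

text \<open>
  Conjugacy in Sylow's theorem: let \<open>P\<close> act by right multiplication on the right cosets of \<open>Q\<close>.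
  A fixed coset \<open>Q g\<close> satisfies \<open>g P \<subseteq> Q g\<close>.
\<close>

lemma prime_power_subgroup_conjugate_into:
  assumes p: "Factorial_Ring.prime p" and fin: "finite (carrier G)"
    and P: "subgroup P G" "card P = p ^ a"
    and Q: "subgroup Q G" "\<not> p dvd card (rcosets Q)"
  obtains g where "g \<in> carrier G" "\<And>u. u \<in> P \<Longrightarrow> g \<otimes> u \<otimes> inv g \<in> Q"
proof -
  interpret P: subgroup P G by fact
  interpret Q: subgroup Q G by fact
  interpret GP: group "G\<lparr>carrier := P\<rparr>" by (rule P.subgroup_is_group) (rule is_group)
  have rc: "\<exists>g\<in>carrier G. R = Q #> g" if "R \<in> rcosets Q" for R
    using that by (auto simp: RCOSETS_def)
  obtain R where R: "R \<in> rcosets Q"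
      "\<And>u. u \<in> carrier (G\<lparr>carrier := P\<rparr>) \<Longrightarrow> R #> inv u = R"
  proof (rule GP.prime_power_action_fixed_point[OF p, of a "rcosets Q" "\<lambda>u R. R #> inv u"])
    show "order (G\<lparr>carrier := P\<rparr>) = p ^ a" using P by (simp add: order_def)
    show "finite (rcosets Q)" using fin by (simp add: RCOSETS_def)
    show "R #> inv u \<in> rcosets Q" if "u \<in> carrier (G\<lparr>carrier := P\<rparr>)" "R \<in> rcosets Q" for u R
      using that rc[of R] by (auto simp: coset_mult_assoc Q.subset intro!: rcosetsI[OF Q.subset])
    show "R #> inv \<one>\<^bsub>G\<lparr>carrier := P\<rparr>\<^esub> = R" if "R \<in> rcosets Q" for R
      using that rc[of R] by (auto simp: coset_mult_assoc Q.subset)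
    show "R #> inv (g \<otimes>\<^bsub>G\<lparr>carrier := P\<rparr>\<^esub> h) = R #> inv h #> inv g"
      if "g \<in> carrier (G\<lparr>carrier := P\<rparr>)" "h \<in> carrier (G\<lparr>carrier := P\<rparr>)" "R \<in> rcosets Q" for g h R
      using that rc[of R] by (auto simp: coset_mult_assoc Q.subset inv_mult_group m_assoc)
  qed (use Q in auto)
  then obtain g where g: "g \<in> carrier G" "R = Q #> g" using rc by blast
  show thesis
  proof (rule that[OF g(1)])
    fix u assume u: "u \<in> P"
    have "Q #> g = R #> inv (inv u)"
      using R(2)[of "inv u"] u g(2) by simp
    also have "\<dots> = Q #> (g \<otimes> u)"
      using u g by (simp add: coset_mult_assoc Q.subset)
    finally have "g \<otimes> u \<in> Q #> g"
      using rcos_self[OF _ Q(1), of "g \<otimes> u"] u g by simp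
    then obtain q where q: "q \<in> Q" "g \<otimes> u = q \<otimes> g"
      by (auto simp: r_coset_def)
    then have "g \<otimes> u \<otimes> inv g = q" using g u by (simp add: m_assoc)
    with q show "g \<otimes> u \<otimes> inv g \<in> Q" by simp
  qed
qed

section \<open>Fusion in a Sylow subgroup central in its normaliser\<close>

lemma subgroup_centralizer:
  assumes "s \<in> carrier G"
  shows "subgroup {c \<in> carrier G. c \<otimes> s = s \<otimes> c} G"
proof (rule subgroupI)
  fix a assume "a \<in> {c \<in> carrier G. c \<otimes> s = s \<otimes> c}"
  then have a: "a \<in> carrier G" "a \<otimes> s = s \<otimes> a" by auto
  have "inv a \<otimes> s = inv a \<otimes> (s \<otimes> a) \<otimes> inv a"
    using a(1) assms by (simp add: m_assoc)
  also have "\<dots> = inv a \<otimes> (a \<otimes> s) \<otimes> inv a" by (simp only: a(2))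
  also have "\<dots> = s \<otimes> inv a" using a(1) assms by (simp add: m_assoc)
  finally show "inv a \<in> {c \<in> carrier G. c \<otimes> s = s \<otimes> c}" using a(1) by simp
next
  fix a b assume "a \<in> {c \<in> carrier G. c \<otimes> s = s \<otimes> c}" "b \<in> {c \<in> carrier G. c \<otimes> s = s \<otimes> c}"
  then show "a \<otimes> b \<in> {c \<in> carrier G. c \<otimes> s = s \<otimes> c}"
    using assms by (simp add: m_assoc) (simp add: m_assoc[symmetric])
qed (use assms in auto)

text \<open>
  Burnside's fusion argument. Let \<open>C\<close> be the centraliser of \<open>r = t s t\<^sup>-\<^sup>1\<close>. As \<open>P\<close> is abelian,
  both \<open>P\<close> and \<open>Q = t P t\<^sup>-\<^sup>1\<close> lie in \<open>C\<close>, and both are Sylow subgroups there, so some \<open>c \<in> C\<close>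
  carries \<open>Q\<close> to \<open>P\<close>. Then \<open>c t\<close> normalises \<open>P\<close>, hence centralises \<open>s\<close>; since \<open>c\<close> fixes \<open>r\<close>, this
  says \<open>r = s\<close>.
\<close>

lemma central_sylow_fusion:
  assumes p: "Factorial_Ring.prime p" and fin: "finite (carrier G)"
    and P: "subgroup P G" "card P = p ^ a" and ord: "order G = p ^ a * m" "\<not> p dvd m"
    and central: "\<And>x u. x \<in> carrier G \<Longrightarrow> (\<And>v. v \<in> P \<Longrightarrow> x \<otimes> v \<otimes> inv x \<in> P) \<Longrightarrow> u \<in> P \<Longrightarrow>
                    x \<otimes> u \<otimes> inv x = u"
    and t: "t \<in> carrier G" and s: "s \<in> P" "t \<otimes> s \<otimes> inv t \<in> P"
  shows "t \<otimes> s \<otimes> inv t = s"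
proof -
  interpret P: subgroup P G by fact
  have comm: "u \<otimes> v = v \<otimes> u" if "u \<in> P" "v \<in> P" for u v
    using that by (intro commute_if_conjugate_fixed central) auto
  let ?r = "t \<otimes> s \<otimes> inv t"
  define C where "C = {c \<in> carrier G. c \<otimes> ?r = ?r \<otimes> c}"
  define Q where "Q = (\<lambda>u. t \<otimes> u \<otimes> inv t) ` P"
  have C_commutes: "c \<otimes> ?r = ?r \<otimes> c" if "c \<in> C" for c
    using that unfolding C_def by blast
  have C: "subgroup C G"
    unfolding C_def using t s by (intro subgroup_centralizer) auto
  interpret C: subgroup C G by (rule C)
  interpret GC: group "G\<lparr>carrier := C\<rparr>" by (rule C.subgroup_is_group) (rule is_group)
  have PC: "P \<subseteq> C"
  proof
    fix u assume "u \<in> P"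
    then have "u \<in> carrier G" "u \<otimes> ?r = ?r \<otimes> u" by (rule P.mem_carrier, rule comm[OF _ s(2)])
    then show "u \<in> C" unfolding C_def by blast
  qed
  have QG: "subgroup Q G"
  proof (rule subgroupI)
    show "Q \<subseteq> carrier G" using t by (auto simp: Q_def)
    show "Q \<noteq> {}" using P.one_closed unfolding Q_def by blast
  next
    fix x assume "x \<in> Q"
    then obtain u where u: "u \<in> P" "x = t \<otimes> u \<otimes> inv t" by (auto simp: Q_def)
    then have "inv x = t \<otimes> inv u \<otimes> inv t" using t by (simp add: inv_mult_group m_assoc)
    then show "inv x \<in> Q" using u by (auto simp: Q_def)
  next
    fix x y assume "x \<in> Q" "y \<in> Q"
    then obtain u v where u: "u \<in> P" "x = t \<otimes> u \<otimes> inv t" "v \<in> P" "y = t \<otimes> v \<otimes> inv t"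
      by (auto simp: Q_def)
    then have "x \<otimes> y = t \<otimes> (u \<otimes> v) \<otimes> inv t" using t by (simp add: m_assoc)
    then show "x \<otimes> y \<in> Q" using u by (auto simp: Q_def)
  qed
  have QC: "Q \<subseteq> C"
  proof
    fix x assume "x \<in> Q"
    then obtain u where u: "u \<in> P" "x = t \<otimes> u \<otimes> inv t" by (auto simp: Q_def)
    have "x \<otimes> ?r = t \<otimes> (u \<otimes> s) \<otimes> inv t" using u t s by (simp add: m_assoc)
    also have "\<dots> = t \<otimes> (s \<otimes> u) \<otimes> inv t" using comm[of u s] u s by simp
    also have "\<dots> = ?r \<otimes> x" using u t s by (simp add: m_assoc)
    finally have "x \<otimes> ?r = ?r \<otimes> x" .
    moreover have "x \<in> carrier G" using u t by simp
    ultimately show "x \<in> C" unfolding C_def by blast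
  qed
  have cardQ: "card Q = p ^ a"
    unfolding Q_def P(2)[symmetric]
  proof (rule card_image, rule inj_onI)
    fix u v assume "u \<in> P" "v \<in> P" "t \<otimes> u \<otimes> inv t = t \<otimes> v \<otimes> inv t"
    then show "u = v" using t by simp
  qed
  let ?n = "card (rcosets\<^bsub>G\<lparr>carrier := C\<rparr>\<^esub> P)"
  have PGC: "subgroup P (G\<lparr>carrier := C\<rparr>)" and QGC: "subgroup Q (G\<lparr>carrier := C\<rparr>)"
    using subgroup_incl[OF P(1) C PC] subgroup_incl[OF QG C QC] .
  have nP: "?n * p ^ a = card C"
    using GC.lagrange[OF PGC] P(2) by (simp add: order_def)
  have "?n dvd m"
  proof -
    have "card (rcosets C) * (?n * p ^ a) = p ^ a * m"
      using lagrange[OF C] ord nP by simp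
    then have "p ^ a * (card (rcosets C) * ?n) = p ^ a * m" by (simp add: ac_simps)
    then show ?thesis using p by (metis dvd_triv_right mult_left_cancel power_not_zero not_prime_0)
  qed
  then have index: "\<not> p dvd ?n" using ord(2) dvd_trans by blast
  obtain c where c: "c \<in> carrier (G\<lparr>carrier := C\<rparr>)"
      "\<And>u. u \<in> Q \<Longrightarrow> c \<otimes>\<^bsub>G\<lparr>carrier := C\<rparr>\<^esub> u \<otimes>\<^bsub>G\<lparr>carrier := C\<rparr>\<^esub> inv\<^bsub>G\<lparr>carrier := C\<rparr>\<^esub> c \<in> P"
    using GC.prime_power_subgroup_conjugate_into[OF p _ QGC cardQ PGC index] fin
      finite_subset[OF C.subset] by auto
  have cC: "c \<in> C" and cG: "c \<in> carrier G" using c(1) by auto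
  have conj: "(c \<otimes> t) \<otimes> u \<otimes> inv (c \<otimes> t) \<in> P" if "u \<in> P" for u
  proof -
    have "c \<otimes> (t \<otimes> u \<otimes> inv t) \<otimes> inv c \<in> P"
      using c(2)[of "t \<otimes> u \<otimes> inv t"] that cC C by (auto simp: Q_def)
    then show ?thesis using that t cG by (simp add: m_assoc inv_mult_group)
  qed
  have "s = (c \<otimes> t) \<otimes> s \<otimes> inv (c \<otimes> t)"
    using central[of "c \<otimes> t" s] conj s cG t by simp
  also have "\<dots> = c \<otimes> ?r \<otimes> inv c"
    using s t cG by (simp add: m_assoc inv_mult_group)
  also have "\<dots> = ?r \<otimes> c \<otimes> inv c"
    by (simp only: C_commutes[OF cC])
  also have "\<dots> = ?r" using s t cG by (simp add: m_assoc)
  finally show ?thesis by simp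
qed

section \<open>Burnside's transfer theorem\<close>

text \<open>
  On each double coset \<open>P t P\<close> put \<open>\<phi> (u t v) = u v\<close>. If \<open>u' t v' = u t v\<close> then conjugation by
  \<open>t\<close> takes \<open>v' v\<^sup>-\<^sup>1\<close> to \<open>u'\<^sup>-\<^sup>1 u\<close>; both lie in \<open>P\<close>, so the fusion hypothesis makes them equal,
  and \<open>u v = u' v'\<close>. The fusion hypothesis also makes \<open>P\<close> abelian, which is why the factor may be
  pulled out on the left when multiplying on the right.
\<close>

lemma equivariant_retraction_exists:
  assumes P: "subgroup P G"
    and fusion: "\<And>t s. t \<in> carrier G \<Longrightarrow> s \<in> P \<Longrightarrow> t \<otimes> s \<otimes> inv t \<in> P \<Longrightarrow> t \<otimes> s \<otimes> inv t = s"
  obtains \<phi> where "\<And>x. x \<in> carrier G \<Longrightarrow> \<phi> x \<in> P"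
    and "\<And>u x. u \<in> P \<Longrightarrow> x \<in> carrier G \<Longrightarrow> \<phi> (u \<otimes> x) = u \<otimes> \<phi> x"
    and "\<And>u x. u \<in> P \<Longrightarrow> x \<in> carrier G \<Longrightarrow> \<phi> (x \<otimes> u) = u \<otimes> \<phi> x"
proof -
  interpret P: subgroup P G by fact
  have comm: "u \<otimes> v = v \<otimes> u" if "u \<in> P" "v \<in> P" for u v
    using that fusion[of v u] by (intro commute_if_conjugate_fixed) simp_all
  \<comment> \<open>\<open>D x\<close> is the double coset of \<open>x\<close>. Choosing \<open>r x\<close> from the set \<open>D x\<close>, rather than from \<open>x\<close>,
    makes the representative the same for all elements of a double coset.\<close>
  define D where "D x = {u \<otimes> x \<otimes> v | u v. u \<in> P \<and> v \<in> P}" for x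
  define r where "r x = (SOME t. t \<in> D x)" for x
  define \<phi> where "\<phi> x = (SOME w. \<exists>u\<in>P. \<exists>v\<in>P. x = u \<otimes> r x \<otimes> v \<and> w = u \<otimes> v)" for x
  have DI: "u \<otimes> x \<otimes> v \<in> D x" if "u \<in> P" "v \<in> P" for u v x
    using that by (auto simp: D_def)
  have self: "x \<in> D x" if "x \<in> carrier G" for x
    using DI[of \<one> \<one> x] that by simp
  have D_left: "D (a \<otimes> x) = D x" if a: "a \<in> P" and x: "x \<in> carrier G" for a x
  proof (rule Set.set_eqI, rule iffI)
    fix y assume "y \<in> D (a \<otimes> x)"
    then obtain u v where "u \<in> P" "v \<in> P" "y = u \<otimes> (a \<otimes> x) \<otimes> v" by (auto simp: D_def)
    then show "y \<in> D x"
      using a x DI[of "u \<otimes> a" v x] by (simp add: m_assoc)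
  next
    fix y assume "y \<in> D x"
    then obtain u v where "u \<in> P" "v \<in> P" "y = u \<otimes> x \<otimes> v" by (auto simp: D_def)
    then show "y \<in> D (a \<otimes> x)"
      using a x DI[of "u \<otimes> inv a" v "a \<otimes> x"] by (simp add: m_assoc)
  qed
  have D_right: "D (x \<otimes> a) = D x" if a: "a \<in> P" and x: "x \<in> carrier G" for a x
  proof (rule Set.set_eqI, rule iffI)
    fix y assume "y \<in> D (x \<otimes> a)"
    then obtain u v where "u \<in> P" "v \<in> P" "y = u \<otimes> (x \<otimes> a) \<otimes> v" by (auto simp: D_def)
    then show "y \<in> D x"
      using a x DI[of u "a \<otimes> v" x] by (simp add: m_assoc)
  next
    fix y assume "y \<in> D x"
    then obtain u v where "u \<in> P" "v \<in> P" "y = u \<otimes> x \<otimes> v" by (auto simp: D_def)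
    then show "y \<in> D (x \<otimes> a)"
      using a x DI[of u "inv a \<otimes> v" "x \<otimes> a"] by (simp add: m_assoc)
  qed
  have ex: "r x \<in> carrier G \<and> (\<exists>u\<in>P. \<exists>v\<in>P. x = u \<otimes> r x \<otimes> v)" if x: "x \<in> carrier G" for x
  proof -
    have "r x \<in> D x" unfolding r_def using self[OF x] by (rule someI)
    then obtain u v where uv: "u \<in> P" "v \<in> P" "r x = u \<otimes> x \<otimes> v" by (auto simp: D_def)
    then have "x = inv u \<otimes> r x \<otimes> inv v" using x by (simp add: m_assoc)
    moreover have "r x \<in> carrier G" using uv x by simp
    ultimately show ?thesis using uv P.m_inv_closed by blast
  qed
  have uniq: "\<phi> x = u \<otimes> v" if x: "x = u \<otimes> r x \<otimes> v" "x \<in> carrier G" and uv: "u \<in> P" "v \<in> P" for x u v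
  proof -
    let ?t = "r x"
    have t: "?t \<in> carrier G" using ex x by blast
    have "\<exists>u'\<in>P. \<exists>v'\<in>P. x = u' \<otimes> ?t \<otimes> v' \<and> \<phi> x = u' \<otimes> v'"
      unfolding \<phi>_def by (rule someI_ex) (use x uv in blast)
    then obtain u' v' where u'v': "u' \<in> P" "v' \<in> P" "x = u' \<otimes> ?t \<otimes> v'" "\<phi> x = u' \<otimes> v'" by blast
    have eq: "u' \<otimes> ?t \<otimes> v' = u \<otimes> ?t \<otimes> v" using x u'v' by simp
    have "?t \<otimes> (v' \<otimes> inv v) \<otimes> inv ?t = inv u' \<otimes> (u' \<otimes> ?t \<otimes> v') \<otimes> inv v \<otimes> inv ?t"
      using u'v'(1,2) uv t by (simp add: m_assoc)
    also have "\<dots> = inv u' \<otimes> u" unfolding eq using u'v'(1,2) uv t by (simp add: m_assoc)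
    finally have *: "?t \<otimes> (v' \<otimes> inv v) \<otimes> inv ?t = inv u' \<otimes> u" .
    have "?t \<otimes> (v' \<otimes> inv v) \<otimes> inv ?t = v' \<otimes> inv v"
      by (rule fusion[OF t]) (use * u'v'(1,2) uv in auto)
    with * have "v' \<otimes> inv v = inv u' \<otimes> u" by simp
    then have "u' \<otimes> (v' \<otimes> inv v) \<otimes> v = u' \<otimes> (inv u' \<otimes> u) \<otimes> v" by simp
    then show ?thesis using u'v'(1,2,4) uv by (simp add: m_assoc)
  qed
  show thesis
  proof (rule that)
    fix x assume x: "x \<in> carrier G"
    then obtain u v where "u \<in> P" "v \<in> P" "x = u \<otimes> r x \<otimes> v" using ex by blast
    then show "\<phi> x \<in> P" using uniq x by simp
  next
    fix a x assume a: "a \<in> P" and x: "x \<in> carrier G"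
    then obtain u v where uv: "u \<in> P" "v \<in> P" "x = u \<otimes> r x \<otimes> v" and t: "r x \<in> carrier G"
      using ex by blast
    have \<phi>x: "\<phi> x = u \<otimes> v" using uniq uv x by simp
    have r: "r (a \<otimes> x) = r x" "r (x \<otimes> a) = r x"
      using D_left[OF a x] D_right[OF a x] by (simp_all add: r_def)
    have "\<phi> (a \<otimes> x) = (a \<otimes> u) \<otimes> v"
    proof (rule uniq)
      have "a \<otimes> x = a \<otimes> (u \<otimes> r x \<otimes> v)" using uv by simp
      then show "a \<otimes> x = a \<otimes> u \<otimes> r (a \<otimes> x) \<otimes> v"
        using a uv(1,2) t unfolding r by (simp add: m_assoc)
    qed (use a x uv in auto)
    then show "\<phi> (a \<otimes> x) = a \<otimes> \<phi> x" using \<phi>x a uv(1,2) by (simp add: m_assoc)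
    have "\<phi> (x \<otimes> a) = u \<otimes> (v \<otimes> a)"
    proof (rule uniq)
      have "x \<otimes> a = (u \<otimes> r x \<otimes> v) \<otimes> a" using uv by simp
      then show "x \<otimes> a = u \<otimes> r (x \<otimes> a) \<otimes> (v \<otimes> a)"
        using a uv(1,2) t unfolding r by (simp add: m_assoc)
    qed (use a x uv in auto)
    also have "\<dots> = \<phi> x \<otimes> a" using \<phi>x a uv(1,2) by (simp add: m_assoc)
    also have "\<dots> = a \<otimes> \<phi> x" using \<phi>x a uv(1,2) comm[of "u \<otimes> v" a] by simp
    finally show "\<phi> (x \<otimes> a) = a \<otimes> \<phi> x" .
  qed
qed

text \<open>
  The equivariant map \<open>\<phi>\<close> splits every \<open>x\<close> as \<open>\<phi> x\<close> times a unique element \<open>\<tau> x\<close> of the transversal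
  \<open>T\<close>. The transfer \<open>V g\<close> is the product of \<open>\<phi> (t g)\<close> over \<open>t \<in> T\<close>. It is a homomorphism because
  \<open>t \<mapsto> \<tau> (t g)\<close> permutes \<open>T\<close>, and its target is abelian, so it kills \<open>G'\<close>. On \<open>u \<in> P\<close> the right
  equivariance of \<open>\<phi>\<close> turns every factor into \<open>u\<close>, so an element of \<open>P \<inter> G'\<close> has an order dividing
  both the order and the index of \<open>P\<close>.
\<close>

theorem burnside_transfer:
  assumes fin: "finite (carrier G)" and P: "subgroup P G"
    and coprime: "coprime (card P) (card (rcosets P))"
    and fusion: "\<And>t s. t \<in> carrier G \<Longrightarrow> s \<in> P \<Longrightarrow> t \<otimes> s \<otimes> inv t \<in> P \<Longrightarrow> t \<otimes> s \<otimes> inv t = s"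
  shows "P \<inter> derived G (carrier G) = {\<one>}"
proof -
  interpret P: subgroup P G by fact
  let ?P = "G\<lparr>carrier := P\<rparr>"
  interpret GP: group ?P by (rule P.subgroup_is_group) (rule is_group)
  have comm: "u \<otimes> v = v \<otimes> u" if "u \<in> P" "v \<in> P" for u v
    using that fusion[of v u] by (intro commute_if_conjugate_fixed) simp_all
  interpret CP: comm_group ?P by (rule GP.group_comm_groupI) (simp add: comm)
  obtain \<phi> where \<phi>: "\<And>x. x \<in> carrier G \<Longrightarrow> \<phi> x \<in> P"
    "\<And>u x. u \<in> P \<Longrightarrow> x \<in> carrier G \<Longrightarrow> \<phi> (u \<otimes> x) = u \<otimes> \<phi> x"
    "\<And>u x. u \<in> P \<Longrightarrow> x \<in> carrier G \<Longrightarrow> \<phi> (x \<otimes> u) = u \<otimes> \<phi> x"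
    using equivariant_retraction_exists[OF P fusion] by blast
  define T where "T = {t \<in> carrier G. \<phi> t = \<one>}"
  define \<tau> where "\<tau> x = inv (\<phi> x) \<otimes> x" for x
  define V where "V g = finprod ?P (\<lambda>t. \<phi> (t \<otimes> g)) T" for g
  have T_sub: "t \<in> carrier G" if "t \<in> T" for t using that by (simp add: T_def)
  have finT: "finite T" using fin by (simp add: T_def)
  have \<tau>T: "\<tau> x \<in> T" if "x \<in> carrier G" for x
    using that \<phi>(1)[OF that] \<phi>(2)[of "inv (\<phi> x)" x] by (simp add: T_def \<tau>_def)
  have \<tau>_split: "x = \<phi> x \<otimes> \<tau> x" if "x \<in> carrier G" for x
    using that \<phi>(1)[OF that] by (simp add: \<tau>_def)
  have cardT: "card T * card P = order G"
  proof -
    have "bij_betw (\<lambda>(t, u). u \<otimes> t) (T \<times> P) (carrier G)"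
    proof (rule bij_betwI[where g = "\<lambda>x. (\<tau> x, \<phi> x)"])
      show "(\<lambda>(t, u). u \<otimes> t) \<in> T \<times> P \<rightarrow> carrier G" using T_sub by auto
      show "(\<lambda>x. (\<tau> x, \<phi> x)) \<in> carrier G \<rightarrow> T \<times> P" using \<tau>T \<phi> by auto
      show "(\<tau> (case x of (t, u) \<Rightarrow> u \<otimes> t), \<phi> (case x of (t, u) \<Rightarrow> u \<otimes> t)) = x"
        if "x \<in> T \<times> P" for x
        using that \<phi>(2) by (auto simp: T_def \<tau>_def)
      show "(case (\<tau> x, \<phi> x) of (t, u) \<Rightarrow> u \<otimes> t) = x" if "x \<in> carrier G" for x
        using \<tau>_split[OF that] by simp
    qed
    then have "card (T \<times> P) = card (carrier G)" by (rule bij_betw_same_card)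
    then show ?thesis by (simp add: card_cartesian_product order_def)
  qed
  then have "card T * card P = card (rcosets P) * card P" using lagrange[OF P] by simp
  moreover have "card P \<noteq> 0"
    using finite_subset[OF P.subset fin] P.one_closed by (metis card_eq_0_iff empty_iff)
  ultimately have index: "card T = card (rcosets P)" by simp
  have closed: "(\<lambda>t. \<phi> (t \<otimes> g)) \<in> T \<rightarrow> carrier ?P" if "g \<in> carrier G" for g
    using that T_sub \<phi>(1) by auto
  have hom: "V \<in> hom G ?P"
  proof (rule homI)
    show "V g \<in> carrier ?P" if "g \<in> carrier G" for g
      unfolding V_def by (rule CP.finprod_closed[OF closed[OF that]])
  next
    fix g h assume g: "g \<in> carrier G" and h: "h \<in> carrier G"
    let ?s = "\<lambda>t. \<tau> (t \<otimes> g)"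
    have s_in: "?s t \<in> T" if "t \<in> T" for t using that \<tau>T T_sub g by simp
    have split: "\<phi> (t \<otimes> (g \<otimes> h)) = \<phi> (t \<otimes> g) \<otimes> \<phi> (?s t \<otimes> h)" if t: "t \<in> T" for t
    proof -
      have "t \<otimes> (g \<otimes> h) = (\<phi> (t \<otimes> g) \<otimes> ?s t) \<otimes> h"
        using \<tau>_split[of "t \<otimes> g"] T_sub[OF t] g h by (simp add: m_assoc)
      also have "\<dots> = \<phi> (t \<otimes> g) \<otimes> (?s t \<otimes> h)"
        using \<phi>(1)[of "t \<otimes> g"] T_sub[OF t] T_sub[OF s_in[OF t]] g h by (simp add: m_assoc)
      finally show ?thesis
        using \<phi>(1)[of "t \<otimes> g"] \<phi>(2) T_sub[OF t] T_sub[OF s_in[OF t]] g h by simp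
    qed
    have inj: "inj_on ?s T"
    proof (rule inj_onI)
      fix t t' assume t: "t \<in> T" and t': "t' \<in> T" and eq: "?s t = ?s t'"
      let ?u = "\<phi> (t \<otimes> g) \<otimes> inv (\<phi> (t' \<otimes> g))"
      have cl: "\<phi> (t \<otimes> g) \<in> P" "\<phi> (t' \<otimes> g) \<in> P" "t \<in> carrier G" "t' \<in> carrier G"
        using \<phi>(1) T_sub t t' g by simp_all
      have "t \<otimes> g = \<phi> (t \<otimes> g) \<otimes> ?s t'"
        using \<tau>_split[of "t \<otimes> g"] cl g eq by simp
      also have "\<dots> = ?u \<otimes> t' \<otimes> g" using cl g by (simp add: \<tau>_def m_assoc)
      finally have tt': "t = ?u \<otimes> t'" using cl g by simp
      have "\<phi> (?u \<otimes> t') = ?u \<otimes> \<phi> t'" using cl by (intro \<phi>(2)) auto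
      then have "?u = \<one>" using tt' t t' cl by (simp add: T_def)
      then show "t = t'" using tt' cl by simp
    qed
    have onto: "?s ` T = T" using finT s_in inj by (intro endo_inj_surj) auto
    have closed': "(\<lambda>t. \<phi> (?s t \<otimes> h)) \<in> T \<rightarrow> carrier ?P"
      using closed[OF h] s_in by (intro funcsetI) (rule funcset_mem)
    have "V (g \<otimes> h) = finprod ?P (\<lambda>t. \<phi> (t \<otimes> g) \<otimes>\<^bsub>?P\<^esub> \<phi> (?s t \<otimes> h)) T"
      unfolding V_def
    proof (rule CP.finprod_cong'[OF refl])
      show "(\<lambda>t. \<phi> (t \<otimes> g) \<otimes>\<^bsub>?P\<^esub> \<phi> (?s t \<otimes> h)) \<in> T \<rightarrow> carrier ?P"
        using funcset_mem[OF closed[OF g]] funcset_mem[OF closed']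
        by (intro funcsetI GP.m_closed)
    qed (simp add: split)
    also have "\<dots> = V g \<otimes>\<^bsub>?P\<^esub> finprod ?P (\<lambda>t. \<phi> (?s t \<otimes> h)) T"
      unfolding V_def by (rule CP.finprod_multf[OF closed[OF g] closed'])
    also have "finprod ?P (\<lambda>t. \<phi> (?s t \<otimes> h)) T = V h"
      unfolding V_def using CP.finprod_reindex[of "\<lambda>t. \<phi> (t \<otimes> h)" ?s T] onto inj closed[OF h]
      by simp
    finally show "V (g \<otimes> h) = V g \<otimes>\<^bsub>?P\<^esub> V h" .
  qed
  then interpret V: group_hom G ?P V
    by (intro group_hom.intro group_hom_axioms.intro is_group GP.is_group)
  have V_derived: "V g = \<one>" if "g \<in> derived G (carrier G)" for g
  proof -
    have "V ` derived G (carrier G) = derived ?P (V ` carrier G)"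
      by (rule V.derived_img[symmetric]) simp
    also have "\<dots> = {\<one>}"
      using CP.derived_eq_singleton[of "V ` carrier G"] V.hom_closed by auto
    finally show ?thesis using that by auto
  qed
  have V_P: "V u = u [^] card T" if u: "u \<in> P" for u
  proof -
    have "V u = finprod ?P (\<lambda>t. u) T"
      unfolding V_def using u \<phi>(3)
      by (intro CP.finprod_cong') (auto simp: T_def)
    also have "\<dots> = u [^]\<^bsub>?P\<^esub> card T" by (rule CP.finprod_const) (use u in simp)
    finally show ?thesis by (simp add: nat_pow_consistent[symmetric])
  qed
  show ?thesis
  proof (intro equalityI subsetI)
    fix u assume u: "u \<in> P \<inter> derived G (carrier G)"
    then have "u [^] card T = \<one>" using V_P V_derived by fastforce
    then have "ord u dvd card T" using u pow_eq_id by auto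
    moreover have "u [^] card P = \<one>"
      using GP.pow_order_eq_1[of u] u nat_pow_consistent by (simp add: order_def)
    then have "ord u dvd card P" using u pow_eq_id by auto
    ultimately have "ord u = 1"
      using coprime index by (metis coprime_common_divisor_nat)
    then show "u \<in> {\<one>}" using u ord_eq_1 by auto
  next
    fix u assume "u \<in> {\<one>}"
    then show "u \<in> P \<inter> derived G (carrier G)"
      using subgroup.one_closed[OF derived_is_subgroup] by auto
  qed
qed

section \<open>Derived subgroups of prime power order in a perfect group\<close>

lemma finite_normalizing_inverse:
  assumes "finite P" "P \<subseteq> carrier G" "x \<in> carrier G"
    and sub: "\<And>u. u \<in> P \<Longrightarrow> x \<otimes> u \<otimes> inv x \<in> P" and "u \<in> P"
  shows "inv x \<otimes> u \<otimes> x \<in> P"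
proof -
  let ?c = "\<lambda>u. x \<otimes> u \<otimes> inv x"
  have "inj_on ?c P"
  proof (rule inj_onI)
    fix u v assume "u \<in> P" "v \<in> P" and eq: "?c u = ?c v"
    then have "u \<in> carrier G" "v \<in> carrier G" using assms(2) by blast+
    then show "u = v" using eq assms(3) by simp
  qed
  then have "?c ` P = P"
    using assms(1) sub by (intro endo_inj_surj) auto
  then obtain v where "v \<in> P" "u = x \<otimes> v \<otimes> inv x" using \<open>u \<in> P\<close> by blast
  then show ?thesis using assms(2,3) subsetD[OF assms(2)] by (simp add: m_assoc)
qed

text \<open>
  \<open>H\<close> consists of the products \<open>u x\<^sup>k\<close> with \<open>u \<in> P\<close>. Modulo \<open>P\<close> such products multiply by adding
  exponents, so \<open>g h\<close> and \<open>h g\<close> differ by an element of \<open>P\<close>.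
\<close>

lemma derived_cyclic_extension:
  assumes P: "subgroup P G" "finite P" and x: "x \<in> carrier G"
    and norm: "\<And>u. u \<in> P \<Longrightarrow> x \<otimes> u \<otimes> inv x \<in> P"
  obtains H where "subgroup H G" "P \<subseteq> H" "x \<in> H" "derived G H \<subseteq> P"
proof -
  interpret P: subgroup P G by fact
  \<comment> \<open>Both conjugations are required in \<open>N\<close> so that closure under inverses is immediate; it then
    contains all integer powers of \<open>x\<close>.\<close>
  define N where "N = {g \<in> carrier G. \<forall>u\<in>P. g \<otimes> u \<otimes> inv g \<in> P \<and> inv g \<otimes> u \<otimes> g \<in> P}"
  have N: "subgroup N G"
  proof (rule subgroupI)
    fix a b assume "a \<in> N" "b \<in> N"
    then have ab: "a \<in> carrier G" "b \<in> carrier G"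
      and "\<And>u. u \<in> P \<Longrightarrow> a \<otimes> (b \<otimes> u \<otimes> inv b) \<otimes> inv a \<in> P"
      and "\<And>u. u \<in> P \<Longrightarrow> inv b \<otimes> (inv a \<otimes> u \<otimes> a) \<otimes> b \<in> P"
      by (auto simp: N_def)
    then show "a \<otimes> b \<in> N" by (simp add: N_def m_assoc inv_mult_group)
  qed (use P.one_closed in \<open>auto simp: N_def\<close>)
  have "x \<in> N"
    using x norm finite_normalizing_inverse[OF P(2) P.subset x norm] by (simp add: N_def)
  then have xk: "x [^] k \<otimes> u \<otimes> inv (x [^] k) \<in> P" if "u \<in> P" for k :: int and u
    using subgroup_int_pow_closed[OF N, of x k] that by (simp add: N_def)
  define H where "H = (\<lambda>(u, k :: int). u \<otimes> x [^] k) ` (P \<times> UNIV)"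
  have HI: "u \<otimes> x [^] k \<in> H" if "u \<in> P" for u and k :: int
    using that by (auto simp: H_def)
  have prod: "\<exists>w\<in>P. (u \<otimes> x [^] k) \<otimes> (v \<otimes> x [^] l) = w \<otimes> x [^] (k + l)"
    if "u \<in> P" "v \<in> P" for u v and k l :: int
  proof
    show "u \<otimes> (x [^] k \<otimes> v \<otimes> inv (x [^] k)) \<in> P" using xk that by simp
    show "(u \<otimes> x [^] k) \<otimes> (v \<otimes> x [^] l) = u \<otimes> (x [^] k \<otimes> v \<otimes> inv (x [^] k)) \<otimes> x [^] (k + l)"
      using that x by (simp add: m_assoc int_pow_mult)
  qed
  have PH: "u \<in> H" if "u \<in> P" for u
    using HI[OF that, of 0] that by simp
  have xH: "x \<in> H"
    using HI[OF P.one_closed, of 1] x by (simp add: int_pow_1)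
  have H: "subgroup H G"
  proof (rule subgroupI)
    show "H \<subseteq> carrier G" using x by (auto simp: H_def)
    show "H \<noteq> {}" using xH by auto
  next
    fix a assume "a \<in> H"
    then obtain u and k :: int where a: "u \<in> P" "a = u \<otimes> x [^] k" by (auto simp: H_def)
    have "inv a = (\<one> \<otimes> x [^] (- k)) \<otimes> (inv u \<otimes> x [^] (0::int))"
      using a x by (simp add: inv_mult_group int_pow_neg)
    then obtain w where "w \<in> P" "inv a = w \<otimes> x [^] (- k + 0)"
      using prod[of \<one> "inv u" "- k" 0] a by auto
    then show "inv a \<in> H" using HI by simp
  next
    fix a b assume "a \<in> H" "b \<in> H"
    then obtain u v and k l :: int
      where "u \<in> P" "v \<in> P" "a = u \<otimes> x [^] k" "b = v \<otimes> x [^] l" by (auto simp: H_def)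
    then show "a \<otimes> b \<in> H" using prod[of u v k l] HI by auto
  qed
  have "derived_set G H \<subseteq> P"
  proof
    fix y assume "y \<in> derived_set G H"
    then obtain g h where gh: "g \<in> H" "h \<in> H" and y: "y = g \<otimes> h \<otimes> inv g \<otimes> inv h" by auto
    obtain u and k :: int where u: "u \<in> P" "g = u \<otimes> x [^] k" using gh(1) by (auto simp: H_def)
    obtain v and l :: int where v: "v \<in> P" "h = v \<otimes> x [^] l" using gh(2) by (auto simp: H_def)
    obtain a where a: "a \<in> P" "g \<otimes> h = a \<otimes> x [^] (k + l)"
      using prod[OF u(1) v(1)] u(2) v(2) by blast
    obtain b where b: "b \<in> P" "h \<otimes> g = b \<otimes> x [^] (l + k)"
      using prod[OF v(1) u(1)] u(2) v(2) by blast
    have "y = (g \<otimes> h) \<otimes> inv (h \<otimes> g)"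
      using gh subgroup.mem_carrier[OF H] by (simp add: y m_assoc inv_mult_group)
    also have "\<dots> = a \<otimes> inv b"
      unfolding a(2) b(2) using a(1) b(1) x by (simp add: m_assoc inv_mult_group add.commute)
    finally show "y \<in> P" using a b by simp
  qed
  then have "derived G H \<subseteq> P"
    unfolding derived_def by (rule generate_subgroup_incl[OF _ P(1)])
  with H PH xH show thesis using that by blast
qed

lemma derived_nontrivial:
  assumes "H \<subseteq> carrier G" "x \<in> H" "y \<in> H" "x \<otimes> y \<otimes> inv x \<noteq> y"
  shows "derived G H \<noteq> {\<one>}"
proof
  assume "derived G H = {\<one>}"
  moreover have "x \<otimes> y \<otimes> inv x \<otimes> inv y \<in> derived G H"
    unfolding derived_def using assms by (intro generate.incl) blast
  ultimately have "x \<otimes> y \<otimes> inv x \<otimes> inv y = \<one>" by simp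
  moreover have "x \<in> carrier G" "y \<in> carrier G" using assms(1-3) by blast+
  ultimately have "x \<otimes> y \<otimes> inv x = y" using inv_solve_right[of \<one> "x \<otimes> y \<otimes> inv x" y] by simp
  with assms(4) show False by contradiction
qed

text \<open>
  A Sylow subgroup \<open>P\<close> either has a normalising element that does not centralise it, and then the
  cyclic extension by that element has the required derived subgroup, or it is central in its
  normaliser, and then the transfer theorem forces the nontrivial \<open>P\<close> to meet \<open>G' = G\<close> trivially.
\<close>

lemma perfect_prime_power_derived_subgroup:
  assumes fin: "finite (carrier G)" and perfect: "derived G (carrier G) = carrier G"
    and p: "Factorial_Ring.prime p" and dvd: "p dvd order G"
  obtains H i where "subgroup H G" "card (derived G H) = p ^ i" "i > 0"
proof -
  note found = that
  define a where "a = multiplicity p (order G)"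
  have "order G \<noteq> 0" using fin order_gt_0_iff_finite by simp
  then obtain m where m: "order G = p ^ a * m" "\<not> p dvd m"
    using p multiplicity_decompose'[of "order G" p] unfolding a_def by (metis not_prime_unit)
  have a: "a > 0" using m dvd by (cases a) auto
  obtain P where P: "subgroup P G" "card P = p ^ a"
    using sylow_thm[OF p is_group m(1) fin] by blast
  interpret P: subgroup P G by (rule P(1))
  have finP: "finite P" using finite_subset[OF P.subset fin] .
  have in_P: thesis if H: "subgroup H G" "derived G H \<subseteq> P" "derived G H \<noteq> {\<one>}" for H
  proof -
    have D: "subgroup (derived G H) G" using derived_is_subgroup subgroup.subset[OF H(1)] .
    interpret GP: group "G\<lparr>carrier := P\<rparr>" by (rule P.subgroup_is_group) (rule is_group)
    have "card (rcosets\<^bsub>G\<lparr>carrier := P\<rparr>\<^esub> (derived G H)) * card (derived G H) = p ^ a"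
      using GP.lagrange[OF subgroup_incl[OF D P(1) H(2)]] P(2) by (simp add: order_def)
    then have "card (derived G H) dvd p ^ a" by (metis dvd_triv_right)
    then obtain i where i: "card (derived G H) = p ^ i"
      using p divides_primepow_nat by blast
    have "i \<noteq> 0"
    proof
      assume "i = 0"
      then have "card (derived G H) = 1" using i by simp
      then show False using H(3) subgroup.one_closed[OF D] by (metis card_1_singletonE singletonD)
    qed
    then show thesis using found[OF H(1) i] by simp
  qed
  show thesis
  proof (cases "\<exists>x\<in>carrier G. \<exists>u\<in>P. (\<forall>v\<in>P. x \<otimes> v \<otimes> inv x \<in> P) \<and> x \<otimes> u \<otimes> inv x \<noteq> u")
    case True
    then obtain x u where x: "x \<in> carrier G" and u: "u \<in> P" "x \<otimes> u \<otimes> inv x \<noteq> u"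
      and norm: "\<And>v. v \<in> P \<Longrightarrow> x \<otimes> v \<otimes> inv x \<in> P" by blast
    obtain H where H: "subgroup H G" "P \<subseteq> H" "x \<in> H" "derived G H \<subseteq> P"
      by (rule derived_cyclic_extension[OF P(1) finP x norm])
    have "derived G H \<noteq> {\<one>}"
      by (rule derived_nontrivial[OF subgroup.subset[OF H(1)] H(3) subsetD[OF H(2) u(1)] u(2)])
    then show thesis by (rule in_P[OF H(1,4)])
  next
    case False
    have central: "x \<otimes> u \<otimes> inv x = u"
      if "x \<in> carrier G" "\<And>v. v \<in> P \<Longrightarrow> x \<otimes> v \<otimes> inv x \<in> P" "u \<in> P" for x u
    proof -
      have "\<forall>v\<in>P. x \<otimes> v \<otimes> inv x \<in> P" using that(2) by (rule ballI)
      then show ?thesis using False that(1,3) by blast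
    qed
    have "card (rcosets P) * p ^ a = p ^ a * m" using lagrange[OF P(1)] m P(2) by simp
    then have index: "card (rcosets P) = m" using p by (simp add: prime_gt_0_nat)
    have "coprime (card P) (card (rcosets P))"
      unfolding P(2) index using p m(2) by (simp add: prime_imp_coprime coprime_power_left_iff)
    then have "P \<inter> derived G (carrier G) = {\<one>}"
      by (rule burnside_transfer[OF fin P(1)])
         (rule central_sylow_fusion[OF p fin P m central])
    then have "P = {\<one>}" using P.subset by (simp add: perfect Int_absorb2)
    then have "p ^ a = 1" using P(2) by simp
    moreover have "1 < p ^ a" using prime_gt_1_nat[OF p] a by (rule one_less_power)
    ultimately show thesis by (metis less_irrefl)
  qed
qed

end

section \<open>Characteristically simple groups\<close>

lemma (in group) characteristic_derived:
  "characteristic_subgroup (derived G (carrier G)) G"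
  unfolding characteristic_subgroup_def
proof (intro conjI ballI)
  show "subgroup (derived G (carrier G)) G" by (rule derived_is_subgroup) simp
  fix \<phi> assume "\<phi> \<in> auto G"
  then have hom: "\<phi> \<in> hom G G" and img: "\<phi> ` carrier G = carrier G"
    by (auto simp: auto_def Bij_def bij_betw_def)
  interpret \<phi>: group_hom G G \<phi> by unfold_locales (rule hom)
  show "\<phi> ` derived G (carrier G) = derived G (carrier G)"
    using \<phi>.derived_img[of "carrier G"] img by simp
qed

lemma (in group) characteristic_center:
  "characteristic_subgroup {z \<in> carrier G. \<forall>g\<in>carrier G. g \<otimes> z = z \<otimes> g} G"
    (is "characteristic_subgroup ?Z G")
  unfolding characteristic_subgroup_def
proof (intro conjI ballI)
  have "?Z = (\<Inter>g\<in>carrier G. {c \<in> carrier G. c \<otimes> g = g \<otimes> c})"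
    using one_closed by (auto simp: eq_commute)
  then show "subgroup ?Z G"
    using subgroups_Inter[of "(\<lambda>g. {c \<in> carrier G. c \<otimes> g = g \<otimes> c}) ` carrier G"]
      subgroup_centralizer one_closed by auto
next
  fix \<phi> assume "\<phi> \<in> auto G"
  then have hom: "\<phi> \<in> hom G G" and img: "\<phi> ` carrier G = carrier G" and inj: "inj_on \<phi> (carrier G)"
    by (auto simp: auto_def Bij_def bij_betw_def)
  interpret \<phi>: group_hom G G \<phi> by unfold_locales (rule hom)
  have *: "\<phi> z \<in> ?Z \<longleftrightarrow> z \<in> ?Z" if z: "z \<in> carrier G" for z
  proof -
    have "\<phi> z \<in> ?Z \<longleftrightarrow> (\<forall>g\<in>\<phi> ` carrier G. g \<otimes> \<phi> z = \<phi> z \<otimes> g)"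
      using z img by simp
    also have "\<dots> \<longleftrightarrow> (\<forall>g\<in>carrier G. \<phi> (g \<otimes> z) = \<phi> (z \<otimes> g))"
      using z by simp
    also have "\<dots> \<longleftrightarrow> z \<in> ?Z"
      using z inj by (auto simp del: \<phi>.hom_mult dest: inj_onD)
    finally show ?thesis .
  qed
  show "\<phi> ` ?Z = ?Z"
  proof (rule equalityI; rule subsetI)
    fix y assume "y \<in> \<phi> ` ?Z"
    then obtain z where z: "z \<in> ?Z" "y = \<phi> z" by (rule imageE)
    then show "y \<in> ?Z" using *[of z] by simp
  next
    fix y assume y: "y \<in> ?Z"
    then have "y \<in> \<phi> ` carrier G" using img by simp
    then obtain z where z: "z \<in> carrier G" "y = \<phi> z" by (rule imageE)
    then have "z \<in> ?Z" using *[of z] y by simp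
    then show "y \<in> \<phi> ` ?Z" unfolding z(2) by (rule imageI)
  qed
qed

lemma (in group) characteristically_simple_perfect:
  assumes "characteristically_simple G" "\<not> comm_group G"
  shows "derived G (carrier G) = carrier G"
proof -
  obtain x y where xy: "x \<in> carrier G" "y \<in> carrier G" "x \<otimes> y \<noteq> y \<otimes> x"
    using assms(2) group_comm_groupI by blast
  then have "x \<otimes> y \<otimes> inv x \<noteq> y" by (metis inv_solve_right m_closed)
  then have "derived G (carrier G) \<noteq> {\<one>}" using derived_nontrivial xy by blast
  then show ?thesis
    using assms(1) characteristic_derived unfolding characteristically_simple_def by blast
qed

lemma (in group) characteristically_simple_not_prime_power:
  assumes cs: "characteristically_simple G" "\<not> comm_group G" and p: "Factorial_Ring.prime p"
  shows "order G \<noteq> p ^ a"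
proof
  assume ord: "order G = p ^ a"
  let ?Z = "{z \<in> carrier G. \<forall>g\<in>carrier G. g \<otimes> z = z \<otimes> g}"
  have nZ: "?Z \<noteq> carrier G" using cs(2) group_comm_groupI by blast
  then have Z: "?Z = {\<one>}"
    using cs(1) characteristic_center unfolding characteristically_simple_def by blast
  obtain z where "z \<in> carrier G" "z \<noteq> \<one>" "\<And>g. g \<in> carrier G \<Longrightarrow> g \<otimes> z = z \<otimes> g"
    by (rule prime_power_group_central_element[OF p ord]) (use Z nZ in auto)
  then have "z \<in> ?Z" by blast
  with Z \<open>z \<noteq> \<one>\<close> show False by blast
qed

lemma (in group) trivial_derived_subgroup: "{\<one>} \<in> derived_subgroups G"
proof -
  have "derived G {\<one>} = {\<one>}"
    using derived_incl[of "{\<one>}" "{\<one>}"] triv_subgroup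
      subgroup.one_closed[OF derived_is_subgroup[of "{\<one>}"]] by auto
  then show ?thesis
    unfolding derived_subgroups_def using triv_subgroup by (metis (mono_tags, lifting) mem_Collect_eq)
qed

section \<open>Counting isomorphism classes by orders\<close>

text \<open>
  Isomorphic groups have the same order, so the order factors through the isomorphism classes.
\<close>

lemma Dn_group_card_orders_le:
  assumes "Dn_group n G"
  shows "finite (card ` derived_subgroups G)" and "card (card ` derived_subgroups G) \<le> n"
proof -
  let ?S = "derived_subgroups G" and ?R = "derived_iso_rel G"
  have fin: "finite (?S // ?R)" and n: "card (?S // ?R) = n" and "group G"
    using assms by (auto simp: Dn_group_def)
  then have eq: "equiv ?S ?R" by (simp add: group.equiv_derived_iso_rel)
  have same: "card A = card B" if "(A, B) \<in> ?R" for A B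
    using that iso_same_card[of "G\<lparr>carrier := A\<rparr>" "G\<lparr>carrier := B\<rparr>"]
    by (simp add: derived_iso_rel_def)
  have sub: "card ` ?S \<subseteq> (\<lambda>C. card (SOME A. A \<in> C)) ` (?S // ?R)"
  proof
    fix k assume "k \<in> card ` ?S"
    then obtain A where A: "A \<in> ?S" "k = card A" by blast
    have "A \<in> ?R `` {A}" using eq A equiv_class_self by fastforce
    then have "(A, SOME B. B \<in> ?R `` {A}) \<in> ?R" by (metis Image_singleton_iff someI)
    then have "k = card (SOME B. B \<in> ?R `` {A})" using same A by simp
    then show "k \<in> (\<lambda>C. card (SOME A. A \<in> C)) ` (?S // ?R)"
      using A quotientI by fast
  qed
  show "finite (card ` ?S)" using finite_subset[OF sub] fin by simp
  show "card (card ` ?S) \<le> n"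
    using surj_card_le[OF fin sub] n by simp
qed

theorem theorem2p5:
  fixes G :: "('a, 'b) monoid_scheme" and n :: nat
  assumes "group G"
    and "finite (carrier G)"
    and "\<not> comm_group G"
    and "characteristically_simple G"
    and "Dn_group n G"
  shows "n \<ge> card (prime_factors (order G)) + 2"
proof -
  interpret group G by fact
  let ?\<pi> = "prime_factors (order G)" and ?O = "card ` derived_subgroups G"
  have perfect: "derived G (carrier G) = carrier G"
    using characteristically_simple_perfect assms by blast
  have "\<exists>i>0. p ^ i \<in> ?O" if "p \<in> ?\<pi>" for p
  proof -
    have p: "Factorial_Ring.prime p" "p dvd order G" using that by (auto simp: in_prime_factors_iff)
    obtain H i where "subgroup H G" "card (derived G H) = p ^ i" "i > 0"
      using perfect_prime_power_derived_subgroup[OF assms(2) perfect p] by blast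
    then have "p ^ i \<in> ?O" unfolding derived_subgroups_def by (auto intro!: image_eqI[of _ card "derived G H"])
    with \<open>i > 0\<close> show ?thesis by blast
  qed
  then obtain e where e: "\<And>p. p \<in> ?\<pi> \<Longrightarrow> e p > 0 \<and> p ^ e p \<in> ?O" by metis
  \<comment> \<open>\<open>K\<close> collects one nontrivial prime power for each prime; together with \<open>1\<close> and the order of
    \<open>G\<close> its elements are the orders that are counted.\<close>
  define K where "K = (\<lambda>p. p ^ e p) ` ?\<pi>"
  have inj: "inj_on (\<lambda>p. p ^ e p) ?\<pi>"
  proof (rule inj_onI)
    fix p q assume pq: "p \<in> ?\<pi>" "q \<in> ?\<pi>" and eq: "p ^ e p = q ^ e q"
    have "Factorial_Ring.prime p" "Factorial_Ring.prime q" "e p > 0" using pq e by (auto simp: in_prime_factors_iff)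
    moreover have "p dvd q ^ e q" using eq \<open>e p > 0\<close> by (metis dvd_power)
    ultimately show "p = q" using prime_dvd_power primes_dvd_imp_eq by blast
  qed
  have "1 < p ^ e p" if "p \<in> ?\<pi>" for p
    using that e[OF that] by (intro one_less_power prime_gt_1_nat) (auto simp: in_prime_factors_iff)
  then have 1: "1 \<notin> K" by (force simp: K_def)
  have G: "order G \<notin> K"
    using characteristically_simple_not_prime_power assms by (auto simp: K_def in_prime_factors_iff)
  have ne: "order G \<noteq> 1"
    using characteristically_simple_not_prime_power[OF assms(4,3) two_is_prime_nat, of 0] by simp
  have "{\<one>\<^bsub>G\<^esub>} \<in> derived_subgroups G" by (rule trivial_derived_subgroup)
  then have O1: "1 \<in> ?O" by force
  have "carrier G \<in> derived_subgroups G"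
    unfolding derived_subgroups_def using perfect subgroup_self by (metis (mono_tags, lifting) mem_Collect_eq)
  then have OG: "order G \<in> ?O" by (simp add: order_def)
  have "card ?\<pi> + 2 = card (insert 1 (insert (order G) K))"
    using 1 G ne card_image[OF inj] by (simp add: K_def)
  also have "\<dots> \<le> card ?O"
    using O1 OG e Dn_group_card_orders_le(1)[OF assms(5)]
    by (intro card_mono) (auto simp: K_def)
  also have "\<dots> \<le> n" by (rule Dn_group_card_orders_le(2)[OF assms(5)])
  finally show ?thesis .
qed

end
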